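(* Let $G$ be a $d_G$-regular graph and $H$ a $d_H$-regular graph. If $\gamma_P(H)=1$ and $\gamma(G)=1$, then $\operatorname{Z}(G*H)=d_G|V(H)|+d_H$.
   Context: All graphs are finite, simple and undirected. The lexicographic product $G*H$ has vertex set $V(G)\times V(H)$, with $(g,h)$ adjacent to $(g',h')$ iff either $g\sim g'$ in $G$, or $g=g'$ and $h\sim h'$ in $H$. $\gamma(G)$ is the domination number: the minimum size of a set $S$ such that every vertex is in $S$ or adjacent to a vertex of $S$. Power domination: for $S\subseteq V(H)$ define $PD(S)$ by first setting $PD(S):=N[S]$ (the closed neighborhood of $S$), and then, while there is a vertex $v\in PD(S)$ with exactly one neighbor outside $PD(S)$, adding all neighbors of $v$ to $PD(S)$. $S$ is a power dominating set if at the end $PD(S)=V(H)$; $\gamma_P(H)$ is the minimum cardinality of a power dominating set. Zero forcing: vertices are colored blue or white; if a blue vertex $u$ has exactly one white neighbor $w$, then $w$ is changed to blue. A zero forcing set is a set $B$ of vertices such that, coloring $B$ blue and all others white, repeated application of this rule colors all vertices blue; $\operatorname{Z}$ denotes the minimum cardinality of a zero forcing set.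
   Formalization: The formal theorem additionally assumes that d_G and d_H are not both 0; this excludes only G = H = K_1, where the stated formula gives 0 although Z(K_1) = 1. *)

theory Defs
  imports "Graph_Theory.Pair_Digraph"
begin

text \<open>
  Finite simple undirected graphs are the finite, loop-free, symmetric pair digraphs
  of the locale \<^locale>\<open>pair_graph\<close>: an undirected edge is a pair of opposite arcs.
\<close>

definition nbrs :: "'a pair_pre_digraph \<Rightarrow> 'a \<Rightarrow> 'a set" where
  "nbrs G v = {w. (v, w) \<in> parcs G}"

definition regular :: "'a pair_pre_digraph \<Rightarrow> nat \<Rightarrow> bool" where
  "regular G d \<longleftrightarrow> (\<forall>v \<in> pverts G. card (nbrs G v) = d)"

definition lex_product ::
    "'a pair_pre_digraph \<Rightarrow> 'b pair_pre_digraph \<Rightarrow> ('a \<times> 'b) pair_pre_digraph" where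
  "lex_product G H =
     \<lparr> pverts = pverts G \<times> pverts H,
       parcs = {((g, h), (g', h')) | g h g' h'.
         g \<in> pverts G \<and> g' \<in> pverts G \<and> h \<in> pverts H \<and> h' \<in> pverts H \<and>
         ((g, g') \<in> parcs G \<or> (g = g' \<and> (h, h') \<in> parcs H))} \<rparr>"

definition closed_nbhd :: "'a pair_pre_digraph \<Rightarrow> 'a set \<Rightarrow> 'a set" where
  "closed_nbhd G S = S \<union> (\<Union>v \<in> S. nbrs G v)"

definition dominating_set :: "'a pair_pre_digraph \<Rightarrow> 'a set \<Rightarrow> bool" where
  "dominating_set G S \<longleftrightarrow>
     S \<subseteq> pverts G \<and> (\<forall>v \<in> pverts G. v \<in> S \<or> (\<exists>u \<in> S. v \<in> nbrs G u))"

definition domination_number :: "'a pair_pre_digraph \<Rightarrow> nat" where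
  "domination_number G = (LEAST k. \<exists>S. dominating_set G S \<and> card S = k)"

definition pd_step :: "'a pair_pre_digraph \<Rightarrow> 'a set \<Rightarrow> 'a set \<Rightarrow> bool" where
  "pd_step G X Y \<longleftrightarrow> (\<exists>v \<in> X. card (nbrs G v - X) = 1 \<and> Y = X \<union> nbrs G v)"

text \<open>
  The order in which steps are performed does not affect the final set, and the full
  vertex set admits no further step; so the process ends with it iff some run reaches it.
  The same applies to zero forcing below.
\<close>

definition power_dominating_set :: "'a pair_pre_digraph \<Rightarrow> 'a set \<Rightarrow> bool" where
  "power_dominating_set G S \<longleftrightarrow>
     S \<subseteq> pverts G \<and> (pd_step G)\<^sup>*\<^sup>* (closed_nbhd G S) (pverts G)"

definition power_domination_number :: "'a pair_pre_digraph \<Rightarrow> nat" where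
  "power_domination_number G = (LEAST k. \<exists>S. power_dominating_set G S \<and> card S = k)"

definition zf_step :: "'a pair_pre_digraph \<Rightarrow> 'a set \<Rightarrow> 'a set \<Rightarrow> bool" where
  "zf_step G B C \<longleftrightarrow> (\<exists>u \<in> B. \<exists>w. nbrs G u - B = {w} \<and> C = insert w B)"

definition zero_forcing_set :: "'a pair_pre_digraph \<Rightarrow> 'a set \<Rightarrow> bool" where
  "zero_forcing_set G B \<longleftrightarrow> B \<subseteq> pverts G \<and> (zf_step G)\<^sup>*\<^sup>* B (pverts G)"

definition zero_forcing_number :: "'a pair_pre_digraph \<Rightarrow> nat" where
  "zero_forcing_number G = (LEAST k. \<exists>B. zero_forcing_set G B \<and> card B = k)"

lemma pair_graph_lex_product:
  assumes "pair_graph G" "pair_graph H"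
  shows "pair_graph (lex_product G H)"
proof -
  interpret G: pair_graph G by fact
  interpret H: pair_graph H by fact
  let ?P = "lex_product G H"
  have fin: "finite (pverts ?P)"
    by (simp add: lex_product_def G.pair_finite_verts H.pair_finite_verts)
  have sub: "parcs ?P \<subseteq> pverts ?P \<times> pverts ?P"
    by (auto simp: lex_product_def)
  have symG: "(b, a) \<in> parcs G" if "(a, b) \<in> parcs G" for a b
    using that G.pair_sym_arcs by (auto simp: symmetric_def sym_def)
  have symH: "(b, a) \<in> parcs H" if "(a, b) \<in> parcs H" for a b
    using that H.pair_sym_arcs by (auto simp: symmetric_def sym_def)
  show ?thesis
  proof
    show "finite (parcs ?P)"
      using sub fin by (meson finite_SigmaI finite_subset)
    show "symmetric (with_proj ?P)"
      by (auto simp: symmetric_def sym_def lex_product_def intro: symG symH)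
    show "fst e \<noteq> snd e" if "e \<in> parcs ?P" for e
      using that G.pair_no_loops H.pair_no_loops by (fastforce simp: lex_product_def)
  qed (use sub fin in auto)
qed

lemma zero_forcing_set_verts: "zero_forcing_set G (pverts G)"
  by (simp add: zero_forcing_set_def)

lemma zero_forcing_set_empty_iff: "zero_forcing_set G {} \<longleftrightarrow> pverts G = {}"
  by (auto simp: zero_forcing_set_def zf_step_def elim: converse_rtranclpE)

text \<open>
  In particular the one-vertex graph, which is 0-regular, has zero forcing number 1 and not 0.
\<close>

lemma zero_forcing_number_pos:
  assumes "finite (pverts G)" "pverts G \<noteq> {}"
  shows "0 < zero_forcing_number G"
proof -
  have "\<exists>B. zero_forcing_set G B \<and> card B = zero_forcing_number G"
    unfolding zero_forcing_number_def
    by (rule LeastI_ex) (use zero_forcing_set_verts in blast)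
  then obtain B where B: "zero_forcing_set G B" "card B = zero_forcing_number G"
    by blast
  have "B \<noteq> {}"
    using B(1) assms(2) zero_forcing_set_empty_iff by metis
  moreover have "finite B"
    using B(1) assms(1) by (auto simp: zero_forcing_set_def intro: finite_subset)
  ultimately show ?thesis
    using B(2)
    by (metis card_gt_0_iff)
qed

end

theory Submission
  imports Defs
begin

text \<open>
  A forcing vertex and all but one of its neighbours are blue, so the zero forcing number is at
  least the minimum degree, and \<open>G * H\<close> is regular of degree \<open>d_G |V(H)| + d_H\<close>.
  Conversely let \<open>g\<close> dominate \<open>G\<close> and \<open>x\<close> power dominate \<open>H\<close>. If all copies of \<open>H\<close> other than
  the one at \<open>g\<close> are blue, zero forcing inside the copy at \<open>g\<close> is zero forcing in \<open>H\<close>. Colouring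
  in addition \<open>N[x]\<close> minus one neighbour of \<open>x\<close> in that copy, \<open>x\<close> forces the omitted neighbour and
  then the power domination steps of \<open>H\<close> are forces. As \<open>|V(G)| = d_G + 1\<close>, this set has the
  size required. If \<open>d_H = 0\<close>, then \<open>H\<close> is a single vertex and the remaining vertex at \<open>g\<close> is forced by
  any neighbour of \<open>g\<close>.
\<close>

section \<open>Neighbourhoods in a simple graph\<close>

lemma finite_nbrs:
  assumes "pair_graph G"
  shows "finite (nbrs G v)"
proof -
  interpret G: pair_graph G by fact
  have "nbrs G v \<subseteq> snd ` parcs G"
    by (force simp: nbrs_def)
  then show ?thesis
    using G.pair_finite_arcs finite_subset by blast
qed

lemma nbrs_subset_pverts:
  assumes "pair_graph G"
  shows "nbrs G v \<subseteq> pverts G"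
proof -
  interpret G: pair_graph G by fact
  show ?thesis
    using G.in_arcsD2 by (auto simp: nbrs_def)
qed

lemma not_in_own_nbrs:
  assumes "pair_graph G"
  shows "v \<notin> nbrs G v"
proof -
  interpret G: pair_graph G by fact
  show ?thesis
    using G.pair_no_loops by (force simp: nbrs_def)
qed

lemma nbrs_nonempty_in_pverts:
  assumes "pair_graph G" "nbrs G v \<noteq> {}"
  shows "v \<in> pverts G"
proof -
  interpret G: pair_graph G by fact
  show ?thesis
    using assms(2) G.in_arcsD1 by (auto simp: nbrs_def)
qed

section \<open>Minimum dominating and power dominating sets\<close>

lemma power_domination_number_attained:
  assumes "pair_graph G"
  shows "\<exists>S. power_dominating_set G S \<and> card S = power_domination_number G"
proof -
  have "closed_nbhd G (pverts G) = pverts G"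
    using nbrs_subset_pverts[OF assms] by (auto simp: closed_nbhd_def)
  then have "power_dominating_set G (pverts G)"
    by (simp add: power_dominating_set_def)
  then show ?thesis
    unfolding power_domination_number_def by - (rule LeastI_ex, blast)
qed

lemma domination_number_attained:
  "\<exists>S. dominating_set G S \<and> card S = domination_number G"
proof -
  have "dominating_set G (pverts G)"
    by (simp add: dominating_set_def)
  then show ?thesis
    unfolding domination_number_def by - (rule LeastI_ex, blast)
qed

text \<open>A vertex that dominates alone is adjacent to all others, so its degree counts
  them.\<close>

lemma regular_dominated_by_vertex:
  assumes G: "pair_graph G" "regular G d" and dom: "dominating_set G {g}"
  shows "g \<in> pverts G" and "card (pverts G - {g}) = d"
proof -
  show g: "g \<in> pverts G"
    using dom by (simp add: dominating_set_def)
  have "pverts G - {g} = nbrs G g"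
    using dom nbrs_subset_pverts[OF G(1)] not_in_own_nbrs[OF G(1)]
    by (auto simp: dominating_set_def)
  then show "card (pverts G - {g}) = d"
    using G(2) g by (simp add: regular_def)
qed

section \<open>Lower bound by the minimum degree\<close>

lemma zero_forcing_set_card_ge_min_degree:
  assumes G: "pair_graph G" "pverts G \<noteq> {}"
    and deg: "\<And>v. v \<in> pverts G \<Longrightarrow> d \<le> card (nbrs G v)"
    and B: "zero_forcing_set G B"
  shows "d \<le> card B"
proof -
  interpret G: pair_graph G by fact
  have sub: "B \<subseteq> pverts G" and run: "(zf_step G)\<^sup>*\<^sup>* B (pverts G)"
    using B by (auto simp: zero_forcing_set_def)
  have fin: "finite B"
    using sub G.pair_finite_verts finite_subset by blast
  from run show ?thesis
  proof (cases rule: converse_rtranclpE)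
    \<comment> \<open>Without any force, \<open>B\<close> is the whole vertex set and contains a
      neighbourhood.\<close>
    case base
    obtain v where v: "v \<in> pverts G"
      using G(2) by blast
    have "card (nbrs G v) \<le> card B"
      using base fin nbrs_subset_pverts[OF G(1)] by (intro card_mono) auto
    then show ?thesis
      using deg[OF v] by simp
  next
    case (step C)
    then obtain u w where u: "u \<in> B" and w: "nbrs G u - B = {w}"
      by (auto simp: zf_step_def)
    have "insert u (nbrs G u - {w}) \<subseteq> B"
      using u w by auto
    then have "card (insert u (nbrs G u - {w})) \<le> card B"
      using fin by (rule card_mono[rotated])
    \<comment> \<open>The blue vertex \<open>u\<close>, not a neighbour of itself, makes up for the
      white \<open>w\<close>.\<close>
    moreover have "card (insert u (nbrs G u - {w})) = card (nbrs G u)"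
      using w finite_nbrs[OF G(1), of u] not_in_own_nbrs[OF G(1), of u]
      by (metis DiffD1 card_insert_disjoint finite_Diff insertI1 card_Suc_Diff1)
    moreover have "d \<le> card (nbrs G u)"
      using deg u sub by blast
    ultimately show ?thesis
      by simp
  qed
qed

section \<open>Degrees in the lexicographic product\<close>

lemma pverts_lex_product [simp]: "pverts (lex_product G H) = pverts G \<times> pverts H"
  by (simp add: lex_product_def)

lemma nbrs_lex_product:
  assumes "pair_graph G" "pair_graph H" "g \<in> pverts G" "h \<in> pverts H"
  shows "nbrs (lex_product G H) (g, h) = nbrs G g \<times> pverts H \<union> {g} \<times> nbrs H h"
  using assms nbrs_subset_pverts[OF assms(1), of g] nbrs_subset_pverts[OF assms(2), of h]
  by (auto simp: nbrs_def lex_product_def)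

lemma regular_lex_product:
  assumes G: "pair_graph G" "regular G d" and H: "pair_graph H" "regular H e"
  shows "regular (lex_product G H) (d * card (pverts H) + e)"
  unfolding regular_def
proof (clarsimp)
  fix g h assume gh: "g \<in> pverts G" "h \<in> pverts H"
  interpret H: pair_graph H by fact
  have "card (nbrs G g \<times> pverts H \<union> {g} \<times> nbrs H h)
      = card (nbrs G g \<times> pverts H) + card ({g} \<times> nbrs H h)"
    using finite_nbrs[OF G(1)] finite_nbrs[OF H(1)] H.pair_finite_verts not_in_own_nbrs[OF G(1)]
    by (intro card_Un_disjoint) auto
  then show "card (nbrs (lex_product G H) (g, h)) = d * card (pverts H) + e"
    using G(2) H(2) gh
    by (simp add: nbrs_lex_product[OF G(1) H(1) gh] regular_def card_cartesian_product)
qed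

section \<open>Zero forcing inside one copy of \<open>H\<close>\<close>

definition fibre_colouring ::
    "'a pair_pre_digraph \<Rightarrow> 'b pair_pre_digraph \<Rightarrow> 'a \<Rightarrow> 'b set \<Rightarrow> ('a \<times> 'b) set" where
  "fibre_colouring G H g X = (pverts G - {g}) \<times> pverts H \<union> {g} \<times> X"

lemma card_fibre_colouring:
  assumes "pair_graph G" "pair_graph H" "finite X"
  shows "card (fibre_colouring G H g X) = card (pverts G - {g}) * card (pverts H) + card X"
proof -
  interpret G: pair_graph G by fact
  interpret H: pair_graph H by fact
  have "card (fibre_colouring G H g X)
      = card ((pverts G - {g}) \<times> pverts H) + card ({g} \<times> X)"
    unfolding fibre_colouring_def
    using assms(3) G.pair_finite_verts H.pair_finite_verts by (intro card_Un_disjoint) auto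
  then show ?thesis
    by (simp add: card_cartesian_product)
qed

text \<open>Since \<open>g\<close> is not its own neighbour, all neighbours of \<open>(g, v)\<close>
  outside the copy at \<open>g\<close> are blue. Its white neighbours are therefore those of
  \<open>v\<close> in \<open>H\<close>.\<close>

lemma zf_step_fibre_colouring:
  assumes G: "pair_graph G" "g \<in> pverts G" and H: "pair_graph H"
    and v: "v \<in> X" "nbrs H v - X = {w}"
  shows "zf_step (lex_product G H) (fibre_colouring G H g X) (fibre_colouring G H g (insert w X))"
proof -
  \<comment> \<open>\<open>X\<close> is an arbitrary set, so this must come from \<open>v\<close>
    having the neighbour \<open>w\<close>.\<close>
  have "v \<in> pverts H"
    using nbrs_nonempty_in_pverts[OF H] v(2) by blast
  then have "nbrs (lex_product G H) (g, v) - fibre_colouring G H g X = {(g, w)}"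
    using v(2) nbrs_subset_pverts[OF G(1), of g] not_in_own_nbrs[OF G(1), of g]
    by (auto simp: nbrs_lex_product[OF G(1) H G(2)] fibre_colouring_def)
  moreover have "(g, v) \<in> fibre_colouring G H g X"
    using v(1) by (simp add: fibre_colouring_def)
  moreover have "fibre_colouring G H g (insert w X) = insert (g, w) (fibre_colouring G H g X)"
    by (auto simp: fibre_colouring_def)
  ultimately show ?thesis
    unfolding zf_step_def by blast
qed

text \<open>A power domination step adds a whole neighbourhood, but only one of its vertices is new,
  so the step is a single force.\<close>

lemma zf_run_of_pd_run:
  assumes G: "pair_graph G" "g \<in> pverts G" and H: "pair_graph H"
    and run: "(pd_step H)\<^sup>*\<^sup>* X Y"
  shows "(zf_step (lex_product G H))\<^sup>*\<^sup>* (fibre_colouring G H g X) (fibre_colouring G H g Y)"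
  using run
proof induction
  case (step Y Z)
  then obtain v w where v: "v \<in> Y" "nbrs H v - Y = {w}" "Z = Y \<union> nbrs H v"
    unfolding pd_step_def by (metis card_1_singletonE)
  then have "Z = insert w Y"
    by auto
  then show ?case
    using step.IH zf_step_fibre_colouring[OF G H v(1,2)] by (simp add: rtranclp.rtrancl_into_rtrancl)
qed simp

lemma fibre_colouring_pverts:
  assumes "g \<in> pverts G"
  shows "fibre_colouring G H g (pverts H) = pverts (lex_product G H)"
  using assms by (auto simp: fibre_colouring_def)

text \<open>The first force, from \<open>x\<close> to \<open>y\<close>, completes the closed
  neighbourhood of \<open>x\<close>, where the power domination run starts. It saves one
  vertex.\<close>

lemma zero_forcing_set_fibre_colouring:
  assumes G: "pair_graph G" "g \<in> pverts G" and H: "pair_graph H"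
    and x: "power_dominating_set H {x}" and y: "y \<in> nbrs H x"
  shows "zero_forcing_set (lex_product G H) (fibre_colouring G H g (insert x (nbrs H x - {y})))"
proof -
  let ?X = "insert x (nbrs H x - {y})"
  have "x \<noteq> y"
    using y not_in_own_nbrs[OF H] by metis
  then have force: "nbrs H x - ?X = {y}" and cl: "insert y ?X = closed_nbhd H {x}"
    using y not_in_own_nbrs[OF H] by (auto simp: closed_nbhd_def)
  have "zf_step (lex_product G H) (fibre_colouring G H g ?X)
      (fibre_colouring G H g (closed_nbhd H {x}))"
    using zf_step_fibre_colouring[OF G H insertI1 force] cl by simp
  moreover have "(zf_step (lex_product G H))\<^sup>*\<^sup>*
      (fibre_colouring G H g (closed_nbhd H {x})) (pverts (lex_product G H))"
    using x zf_run_of_pd_run[OF G H] fibre_colouring_pverts[OF G(2)]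
    unfolding power_dominating_set_def by metis
  moreover have "fibre_colouring G H g ?X \<subseteq> pverts (lex_product G H)"
    using G(2) x nbrs_subset_pverts[OF H]
    by (auto simp: fibre_colouring_def power_dominating_set_def)
  ultimately show ?thesis
    unfolding zero_forcing_set_def by (metis converse_rtranclp_into_rtranclp)
qed

text \<open>The process starts at \<open>{x}\<close> and cannot leave it.\<close>

lemma power_dominating_isolated_vertex:
  assumes "power_dominating_set H {x}" "nbrs H x = {}"
  shows "pverts H = {x}"
proof -
  have "(pd_step H)\<^sup>*\<^sup>* {x} (pverts H)"
    using assms by (simp add: power_dominating_set_def closed_nbhd_def)
  then show ?thesis
    by (cases rule: converse_rtranclpE) (auto simp: pd_step_def assms(2))
qed

text \<open>The copy at \<open>g\<close> has no blue vertex, so the force must come from another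
  copy. As that copy also has one vertex, \<open>(g, x)\<close> is the only white vertex
  left.\<close>

lemma zero_forcing_set_fibre_colouring_singleton:
  assumes G: "pair_graph G" "g \<in> pverts G" "nbrs G g \<noteq> {}"
    and H: "pair_graph H" "pverts H = {x}"
  shows "zero_forcing_set (lex_product G H) (fibre_colouring G H g {})"
proof -
  interpret G: pair_graph G by fact
  obtain u where u: "u \<in> nbrs G g"
    using G(3) by blast
  have uV: "u \<in> pverts G" "u \<noteq> g"
    using u nbrs_subset_pverts[OF G(1)] not_in_own_nbrs[OF G(1)] by blast+
  have gu: "g \<in> nbrs G u"
    using u G.pair_sym_arcs by (auto simp: nbrs_def symmetric_def sym_def)
  have x: "x \<in> pverts H" and nx: "nbrs H x = {}"
    using H nbrs_subset_pverts[OF H(1), of x] not_in_own_nbrs[OF H(1), of x] by auto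
  have "nbrs (lex_product G H) (u, x) - fibre_colouring G H g {} = {(g, x)}"
    using gu nx H(2) nbrs_subset_pverts[OF G(1), of u]
    by (auto simp: nbrs_lex_product[OF G(1) H(1) uV(1) x] fibre_colouring_def)
  moreover have "(u, x) \<in> fibre_colouring G H g {}"
    using uV H(2) by (simp add: fibre_colouring_def)
  moreover have "pverts (lex_product G H) = insert (g, x) (fibre_colouring G H g {})"
    using G(2) H(2) by (auto simp: fibre_colouring_def)
  ultimately have "zf_step (lex_product G H) (fibre_colouring G H g {}) (pverts (lex_product G H))"
    unfolding zf_step_def by blast
  moreover have "fibre_colouring G H g {} \<subseteq> pverts (lex_product G H)"
    by (auto simp: fibre_colouring_def)
  ultimately show ?thesis
    unfolding zero_forcing_set_def by blast
qed

theorem theorem3p9: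
  fixes G :: "'a pair_pre_digraph" and H :: "'b pair_pre_digraph" and d_G d_H :: nat
  assumes "pair_graph G" and "pair_graph H"
    and "regular G d_G" and "regular H d_H"
    and "power_domination_number H = 1" and "domination_number G = 1"
    and "\<not> (d_G = 0 \<and> d_H = 0)"
  shows "zero_forcing_number (lex_product G H) = d_G * card (pverts H) + d_H"
proof -
  let ?P = "lex_product G H" and ?d = "d_G * card (pverts H) + d_H"
  obtain g where "dominating_set G {g}"
    using domination_number_attained[of G] assms(6) by (metis card_1_singletonE)
  note g = regular_dominated_by_vertex[OF assms(1,3) this]
  obtain x where x: "power_dominating_set H {x}"
    using power_domination_number_attained[OF assms(2)] assms(5) by (metis card_1_singletonE)
  have xV: "x \<in> pverts H"
    using x by (simp add: power_dominating_set_def)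
  have lower: "?d \<le> card B" if "zero_forcing_set ?P B" for B
  proof (rule zero_forcing_set_card_ge_min_degree[OF _ _ _ that])
    show "pair_graph ?P"
      by (rule pair_graph_lex_product[OF assms(1,2)])
    show "pverts ?P \<noteq> {}"
      using g(1) xV by auto
    show "?d \<le> card (nbrs ?P v)" if "v \<in> pverts ?P" for v
      using regular_lex_product[OF assms(1,3,2,4)] that unfolding regular_def by (metis order_refl)
  qed
  have upper: "\<exists>B. zero_forcing_set ?P B \<and> card B = ?d"
  proof (cases "nbrs H x = {}")
    case True
    then have dH: "d_H = 0"
      using assms(4) xV by (force simp: regular_def)
    \<comment> \<open>The degrees are not both 0, so \<open>d_G > 0\<close>. For two single vertices
      the formula would give 0, but the zero forcing number is 1.\<close>
    then have "nbrs G g \<noteq> {}"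
      using assms(3,7) g(1) by (force simp: regular_def)
    then have "zero_forcing_set ?P (fibre_colouring G H g {})"
      using zero_forcing_set_fibre_colouring_singleton[OF assms(1) g(1) _ assms(2)]
        power_dominating_isolated_vertex[OF x True] by blast
    moreover have "card (fibre_colouring G H g {}) = ?d"
      by (simp add: card_fibre_colouring[OF assms(1,2)] g(2) dH)
    ultimately show ?thesis
      by blast
  next
    case False
    then obtain y where y: "y \<in> nbrs H x"
      by blast
    \<comment> \<open>Adding \<open>x\<close> balances the omission of \<open>y\<close>.\<close>
    have "card (insert x (nbrs H x - {y})) = d_H"
      using y xV assms(4) finite_nbrs[OF assms(2), of x] not_in_own_nbrs[OF assms(2), of x]
      by (metis DiffD1 card_Suc_Diff1 card_insert_disjoint finite_Diff regular_def)
    then have "card (fibre_colouring G H g (insert x (nbrs H x - {y}))) = ?d"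
      using finite_nbrs[OF assms(2)] g(2) by (simp add: card_fibre_colouring[OF assms(1,2)])
    then show ?thesis
      using zero_forcing_set_fibre_colouring[OF assms(1) g(1) assms(2) x y] by blast
  qed
  show ?thesis
    unfolding zero_forcing_number_def by (rule Least_equality) (use upper lower in auto)
qed

end
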